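(* Let $G$ be a graph with $V(G)=\{g_1,\ldots,g_n\}$ and let $S=\{g_1,\ldots,g_s\}$, where $3\le s\le n$, be such that $G$ is $S$-resistance transitive (so there is a constant $c$ with $R_G(s_1,s_2)=c$ for all $s_1\ne s_2$ in $S$). Let $t$ be a positive integer and let $H_1,\ldots,H_t$ be graphs with $V(H_i)=\{h_{i,1},\ldots,h_{i,n_i}\}$ such that for all $i,j\in\{1,\ldots,t\}$ the graphs $H_i$ and $H_j$ hold relation $\mathcal{U}$ with respect to $h_{i,1}$ and $h_{j,1}$, i.e. $\mathrm{RS}(H_i)=\mathrm{RS}(H_j)$ and $\mathrm{RSV}(H_i,h_{i,1})=\mathrm{RSV}(H_j,h_{j,1})$. Let $\mathcal{H}=(H_1,\ldots,H_t)$ and $T_1=\{h_{1,1},h_{2,1},\ldots,h_{t,1}\}$. Let $A=\{a_1,\ldots,a_p\}$ and $B=\{b_1,\ldots,b_q\}$ be two partitions of $t$ with $p,q\le s$. If $A$ and $B$ are of equal sums of squares, then the graphs $G(S,A,\mathcal{H},T_1)$ and $G(S,B,\mathcal{H},T_1)$ have the same resistance spectrum.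
   Context: All graphs are finite, simple and undirected (not necessarily connected). The resistance distance $R_G(x,y)$ between two vertices of a graph $G$ is the effective resistance between $x$ and $y$ in the electrical network obtained from $G$ by replacing each edge by a unit resistor; by convention $R_G(x,y)=+\infty$ if $x,y$ lie in different connected components (and $+\infty+a=+\infty$). The resistance spectrum $\mathrm{RS}(G)$ is the multiset of the values $R_G(x,y)$ over all unordered pairs of distinct vertices of $G$. For $v\in V(G)$, $\mathrm{RSV}(G,v)$ is the multiset $\{R_G(v,u)\mid u\in V(G)\setminus\{v\}\}$. Partitions: a partition of a positive integer $t$ is a multiset of positive integers with sum $t$. Two different partitions $A=\{a_1,\ldots,a_p\}$ and $B=\{b_1,\ldots,b_q\}$ of the same positive integer are of equal sums of squares if $\sum_{i=1}^p a_i^2=\sum_{i=1}^q b_i^2$. $S$-resistance transitive: let $S\subseteq V(G)$ with $3\le |S|\le |V(G)|$. $G$ is $S$-resistance transitive if (1) for all $u,v\in S$ and every $x\in V(G)\setminus S$, $R_G(x,u)=R_G(x,v)$; and (2) $R_G(u,v)$ takes the same value for all pairs of different vertices $u,v\in S$. The graph $G(S,A,\mathcal{H},T)$: let $S=\{g_{k_1},\ldots,g_{k_s}\}\subseteq V(G)$ with $k_1<\cdots<k_s$, let $A=\{a_1,\ldots,a_p\}$ be a partition of $t$ (listed in a fixed order) with $p\le s$, let $\mathcal{H}=(H_1,\ldots,H_t)$ be graphs (taken vertex-disjoint from each other and from $G$), and let $T$ consist of one chosen vertex $x_i\in V(H_i)$ for each $i=1,\ldots,t$. Then $G(S,A,\mathcal{H},T)$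 is obtained from the disjoint union of $G,H_1,\ldots,H_t$ by identifying, for each $i=1,\ldots,p$, the vertex $g_{k_i}$ with all the vertices $x_m$ for $a_1+\cdots+a_{i-1}+1\le m\le a_1+\cdots+a_i$ into a single vertex. *)

theory Defs
  imports
    "Graph_Theory.Graph_Theory"
    "HOL-Library.Multiset"
    "HOL-Library.Extended_Real"
begin

text \<open>
  A finite simple undirected graph is a \<open>pair_graph\<close>: a finite loop-free symmetric digraph without
  parallel arcs, an undirected edge being the pair of its two opposite arcs.
\<close>

text \<open>
  \<open>f\<close> is the potential of a current of size 1 that enters the network at \<open>x\<close> and leaves it at \<open>y\<close>.
  Every edge has unit resistance, so by Ohm's law the current from \<open>w\<close> to a neighbour \<open>z\<close> is
  \<open>f w - f z\<close>; the equation is Kirchhoff's current law at \<open>w\<close>.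
\<close>

definition unit_current_potential ::
  "'a pair_pre_digraph \<Rightarrow> 'a \<Rightarrow> 'a \<Rightarrow> ('a \<Rightarrow> real) \<Rightarrow> bool" where
  "unit_current_potential G x y f \<longleftrightarrow>
     (\<forall>w\<in>pverts G. (\<Sum>z | (w, z) \<in> parcs G. f w - f z) =
        (if w = x then 1 else 0) - (if w = y then 1 else 0))"

text \<open>
  If \<open>x\<close> and \<open>y\<close> are in the same component, such a potential exists and is determined up to a
  constant on each component, so the voltage \<open>f x - f y\<close> is unique.
\<close>

definition resistance_distance :: "'a pair_pre_digraph \<Rightarrow> 'a \<Rightarrow> 'a \<Rightarrow> ereal" where
  "resistance_distance G x y =
     (if reachable (with_proj G) x y
      then ereal (THE r. \<exists>f. unit_current_potential G x y f \<and> r = f x - f y)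
      else \<infinity>)"

text \<open>The value on an unordered pair; see \<open>pair_resistance_doubleton\<close> below.\<close>

definition pair_resistance :: "'a pair_pre_digraph \<Rightarrow> 'a set \<Rightarrow> ereal" where
  "pair_resistance G e = (THE r. \<exists>x y. e = {x, y} \<and> r = resistance_distance G x y)"

definition resistance_spectrum :: "'a pair_pre_digraph \<Rightarrow> ereal multiset" where
  "resistance_spectrum G =
     image_mset (pair_resistance G) (mset_set {e. e \<subseteq> pverts G \<and> card e = 2})"

definition RSV :: "'a pair_pre_digraph \<Rightarrow> 'a \<Rightarrow> ereal multiset" where
  "RSV G v = image_mset (resistance_distance G v) (mset_set (pverts G - {v}))"

definition relation_U ::
  "'a pair_pre_digraph \<Rightarrow> 'a \<Rightarrow> 'b pair_pre_digraph \<Rightarrow> 'b \<Rightarrow> bool" where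
  "relation_U G u H v \<longleftrightarrow>
     resistance_spectrum G = resistance_spectrum H \<and> RSV G u = RSV H v"

definition resistance_transitive :: "'a pair_pre_digraph \<Rightarrow> 'a set \<Rightarrow> bool" where
  "resistance_transitive G S \<longleftrightarrow>
     S \<subseteq> pverts G \<and> 3 \<le> card S \<and>
     (\<forall>u\<in>S. \<forall>v\<in>S. \<forall>x\<in>pverts G - S. resistance_distance G x u = resistance_distance G x v) \<and>
     (\<exists>c. \<forall>u\<in>S. \<forall>v\<in>S. u \<noteq> v \<longrightarrow> resistance_distance G u v = c)"

definition partition_of :: "nat multiset \<Rightarrow> nat \<Rightarrow> bool" where
  "partition_of A t \<longleftrightarrow> 0 \<notin># A \<and> sum_mset A = t"

definition equal_sums_of_squares :: "nat multiset \<Rightarrow> nat multiset \<Rightarrow> bool" where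
  "equal_sums_of_squares A B \<longleftrightarrow>
     A \<noteq> B \<and> (\<exists>t>0. partition_of A t \<and> partition_of B t) \<and>
     (\<Sum>a\<in>#A. a\<^sup>2) = (\<Sum>b\<in>#B. b\<^sup>2)"

text \<open>
  The graph \<open>G(S, A, \<H>, T)\<close>. The list \<open>ss\<close> enumerates \<open>S\<close> in the order of the indices, \<open>a\<close> lists the
  parts of \<open>A\<close>, and \<open>\<H>\<close>, \<open>T\<close> are given by \<open>H 1, \<dots>, H t\<close> and \<open>x 1, \<dots>, x t\<close> with \<open>t\<close> the sum of \<open>a\<close>.
  List positions start at 0, so \<open>a ! i\<close> is the part usually written with subscript \<open>i + 1\<close>.

  The disjoint union has vertices \<open>Inl v\<close> for \<open>v\<close> in \<open>G\<close> and \<open>Inr (m, v)\<close> for \<open>v\<close> in \<open>H m\<close>. Each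
  class of identified vertices contains exactly one vertex of \<open>G\<close>, which represents the class: the
  quotient map fixes \<open>G\<close> and is \<open>glue_map\<close> on \<open>H m\<close>.
\<close>

definition attachment_vertex :: "'a list \<Rightarrow> nat list \<Rightarrow> nat \<Rightarrow> 'a" where
  "attachment_vertex ss a m =
     ss ! (THE i. i < length a \<and> sum_list (take i a) + 1 \<le> m \<and> m \<le> sum_list (take (Suc i) a))"

definition glue_map ::
  "'a list \<Rightarrow> nat list \<Rightarrow> (nat \<Rightarrow> 'b) \<Rightarrow> nat \<Rightarrow> 'b \<Rightarrow> 'a + nat \<times> 'b" where
  "glue_map ss a x m v = (if v = x m then Inl (attachment_vertex ss a m) else Inr (m, v))"

definition glued_graph ::
  "'a pair_pre_digraph \<Rightarrow> 'a list \<Rightarrow> nat list \<Rightarrow> (nat \<Rightarrow> 'b pair_pre_digraph) \<Rightarrow> (nat \<Rightarrow> 'b)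
   \<Rightarrow> ('a + nat \<times> 'b) pair_pre_digraph" where
  "glued_graph G ss a H x =
     \<lparr> pverts = Inl ` pverts G \<union> (\<Union>m\<in>{1..sum_list a}. glue_map ss a x m ` pverts (H m)),
       parcs = map_prod Inl Inl ` parcs G \<union>
         (\<Union>m\<in>{1..sum_list a}. map_prod (glue_map ss a x m) (glue_map ss a x m) ` parcs (H m)) \<rparr>"

lemma unit_current_potential_swap:
  assumes "unit_current_potential G x y f"
  shows "unit_current_potential G y x (\<lambda>v. - f v)"
  unfolding unit_current_potential_def
proof
  fix w assume "w \<in> pverts G"
  have "(\<Sum>z | (w, z) \<in> parcs G. - f w - - f z) = - (\<Sum>z | (w, z) \<in> parcs G. f w - f z)"
    by (simp add: sum_negf[symmetric])
  then show "(\<Sum>z | (w, z) \<in> parcs G. - f w - - f z) =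
      (if w = y then 1 else 0) - (if w = x then 1 else 0)"
    using assms \<open>w \<in> pverts G\<close> by (simp add: unit_current_potential_def)
qed

lemma resistance_distance_commute:
  assumes "pair_graph G"
  shows "resistance_distance G x y = resistance_distance G y x"
proof -
  interpret pair_graph G by fact
  have "(\<exists>f. unit_current_potential G x y f \<and> r = f x - f y) \<longleftrightarrow>
      (\<exists>f. unit_current_potential G y x f \<and> r = f y - f x)" for r
  proof -
    have *: "\<exists>f. unit_current_potential G v u f \<and> r = f v - f u"
      if "unit_current_potential G u v f" "r = f u - f v" for u v f
      using unit_current_potential_swap[OF that(1)] that(2)
      by (intro exI[of _ "\<lambda>w. - f w"]) simp
    show ?thesis using *[of x y] *[of y x] by blast
  qed
  moreover have "reachable (with_proj G) x y \<longleftrightarrow> reachable (with_proj G) y x"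
    using symmetric_reachable[OF pair_sym_arcs] by blast
  ultimately show ?thesis
    by (simp add: resistance_distance_def)
qed

lemma pair_resistance_doubleton:
  assumes "pair_graph G"
  shows "pair_resistance G {x, y} = resistance_distance G x y"
  unfolding pair_resistance_def
  by (rule the_equality)
    (use resistance_distance_commute[OF assms] in \<open>auto simp: doubleton_eq_iff\<close>)

end

theory Submission
  imports Defs
begin

text \<open>
  In the glued graph every \<open>H m\<close> hangs on the rest of the network at a single vertex, and resistance
  distances add at a cut vertex. So a distance in the glued graph is of one of four kinds: a distance
  of \<open>G\<close>; a distance inside some \<open>H m\<close>; the distance \<open>r\<close> of a vertex of \<open>H m\<close> from its root plus the
  distance in \<open>G\<close> from the attachment vertex \<open>att m\<close> of that root; or \<open>r + R (att m) (att l) + r'\<close> for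
  vertices of two different parts \<open>H m\<close> and \<open>H l\<close>, where \<open>R\<close> is the resistance distance of \<open>G\<close>.
  The first two kinds do not depend on how the parts are distributed over \<open>S\<close>. Neither does the third
  kind, because by resistance transitivity all vertices of \<open>S\<close> see the same multiset of distances in
  \<open>G\<close>. In the fourth kind \<open>R (att m) (att l)\<close> is 0 if the two roots share their attachment vertex,
  and the constant \<open>c\<close> otherwise; since all parts have the same multiset of distances from the root,
  only the number of pairs \<open>(m, l)\<close> with \<open>att m = att l\<close> matters. A vertex that receives \<open>a\<^sub>i\<close> parts
  accounts for \<open>a\<^sub>i\<^sup>2\<close> of these pairs, so the number is the sum of squares of the partition.
  
  Additivity at cut vertices rests on two facts about networks: a unit current between connected
  vertices exists and has a unique voltage (\<open>unit_current_potential_exists\<close>,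
  \<open>unit_current_potential_unique\<close>), and voltages are reciprocal (\<open>voltage_reciprocity\<close>). A block
  hanging at a cut vertex is treated as a retract of the network, the retraction sending everything
  beyond the cut vertex to the cut vertex (locale \<open>network_retract\<close>); this gives
  \<open>resistance_distance_via_cut_vertex\<close>. The comparison of two distributions of the parts is
  \<open>resistance_spectrum_glued_cong\<close>, and the count of pairs is \<open>card_common_attachment\<close>.
\<close>

section \<open>Square linear systems\<close>

text \<open>
  Gaussian elimination, by induction on the unknowns: some equation has a nonzero coefficient at the
  unknown \<open>c\<close>, and subtracting multiples of it from the others leaves a system with one unknown and
  one equation fewer, again with trivial kernel. Rows and columns are indexed by separate sets because
  the pivot row need not carry the same label as the eliminated column.
\<close>

lemma injective_linear_system_solvable:
  fixes A :: "'r \<Rightarrow> 'c \<Rightarrow> 'k::field"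
  assumes "finite C" "finite R" "card R = card C"
    and "\<And>f. \<forall>r\<in>R. (\<Sum>c\<in>C. A r c * f c) = 0 \<Longrightarrow> \<forall>c\<in>C. f c = 0"
  shows "\<exists>f. \<forall>r\<in>R. (\<Sum>c\<in>C. A r c * f c) = b r"
  using assms
proof (induction C arbitrary: R A b rule: finite_induct)
  case empty
  then show ?case by simp
next
  case (insert c C)
  have "\<exists>r\<in>R. A r c \<noteq> 0"
  proof (rule ccontr)
    assume "\<not> ?thesis"
    then have "\<forall>r\<in>R. (\<Sum>j\<in>insert c C. A r j * (if j = c then 1 else 0)) = 0"
      using insert.hyps by (auto intro!: sum.neutral)
    from insert.prems(3)[OF this] show False by simp
  qed
  then obtain r where r: "r \<in> R" "A r c \<noteq> 0" by blast
  define A' where "A' i j = A i j - A i c / A r c * A r j" for i j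
  \<comment> \<open>the value at \<open>c\<close> that makes the pivot equation hold with right-hand side \<open>\<beta>\<close>\<close>
  define extend where
    "extend \<beta> f = f(c := (\<beta> - (\<Sum>j\<in>C. A r j * f j)) / A r c)" for \<beta> and f :: "'c \<Rightarrow> 'k"
  have row: "(\<Sum>j\<in>insert c C. A i j * extend \<beta> f j) =
      A i c / A r c * \<beta> + (\<Sum>j\<in>C. A' i j * f j)" for i \<beta> f
  proof -
    have "(\<Sum>j\<in>C. A i j * extend \<beta> f j) = (\<Sum>j\<in>C. A i j * f j)"
      using insert.hyps by (intro sum.cong) (auto simp: extend_def)
    moreover have "(\<Sum>j\<in>C. A' i j * f j) =
        (\<Sum>j\<in>C. A i j * f j) - A i c / A r c * (\<Sum>j\<in>C. A r j * f j)"
      by (simp add: A'_def left_diff_distrib sum_subtractf sum_distrib_left mult.assoc)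
    ultimately show ?thesis
      using insert.hyps by (simp add: extend_def right_diff_distrib diff_divide_distrib)
  qed
  have pivot: "A' r j = 0" for j
    using r by (simp add: A'_def)
  have "\<exists>f. \<forall>i\<in>R - {r}. (\<Sum>j\<in>C. A' i j * f j) = b i - A i c / A r c * b r"
  proof (rule insert.IH)
    show "finite (R - {r})" "card (R - {r}) = card C"
      using insert r by auto
    fix f assume f: "\<forall>i\<in>R - {r}. (\<Sum>j\<in>C. A' i j * f j) = 0"
    have "\<forall>i\<in>R. (\<Sum>j\<in>insert c C. A i j * extend 0 f j) = 0"
    proof
      fix i assume "i \<in> R"
      then show "(\<Sum>j\<in>insert c C. A i j * extend 0 f j) = 0"
        unfolding row using f pivot by (cases "i = r") auto
    qed
    from insert.prems(3)[OF this] show "\<forall>j\<in>C. f j = 0"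
      using insert.hyps by (auto simp: extend_def split: if_splits)
  qed
  then obtain f where f: "\<And>i. i \<in> R - {r} \<Longrightarrow> (\<Sum>j\<in>C. A' i j * f j) = b i - A i c / A r c * b r"
    by blast
  have "\<forall>i\<in>R. (\<Sum>j\<in>insert c C. A i j * extend (b r) f j) = b i"
  proof
    fix i assume "i \<in> R"
    then show "(\<Sum>j\<in>insert c C. A i j * extend (b r) f j) = b i"
      unfolding row using f[of i] pivot r by (cases "i = r") auto
  qed
  then show ?case by blast
qed

section \<open>Currents and voltages\<close>

text \<open>
  The graph Laplacian applied to \<open>f\<close>: the net current that leaves \<open>w\<close> when \<open>f\<close> is the potential.
\<close>

definition outflow :: "'a pair_pre_digraph \<Rightarrow> ('a \<Rightarrow> real) \<Rightarrow> 'a \<Rightarrow> real" where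
  "outflow G f w = (\<Sum>z | (w, z) \<in> parcs G. f w - f z)"

definition unit_source :: "'a \<Rightarrow> 'a \<Rightarrow> 'a \<Rightarrow> real" where
  "unit_source x y w = (if w = x then 1 else 0) - (if w = y then 1 else 0)"

lemma unit_current_potential_iff_outflow:
  "unit_current_potential G x y f \<longleftrightarrow> (\<forall>w\<in>pverts G. outflow G f w = unit_source x y w)"
  by (simp add: unit_current_potential_def outflow_def unit_source_def)

lemma outflow_diff: "outflow G (\<lambda>v. f v - k v) w = outflow G f w - outflow G k w"
  by (simp add: outflow_def sum_subtractf[symmetric] algebra_simps)

lemma outflow_add: "outflow G (\<lambda>v. f v + k v) w = outflow G f w + outflow G k w"
  by (simp add: outflow_def sum.distrib[symmetric] algebra_simps)

text \<open>
  Summation against a unit source reads off a voltage; with Green's identity this turns statements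
  about voltages into statements about the Laplacian.
\<close>

lemma sum_unit_source:
  assumes "finite V" "x \<in> V" "y \<in> V"
  shows "(\<Sum>w\<in>V. d w * unit_source x y w) = d x - d y"
proof -
  have "d w * unit_source x y w = (if w = x then d w else 0) - (if w = y then d w else 0)" for w
    by (simp add: unit_source_def)
  then show ?thesis using assms by (simp add: sum_subtractf)
qed

context pair_graph
begin

abbreviation connected_to :: "'a \<Rightarrow> 'a \<Rightarrow> bool" where
  "connected_to \<equiv> reachable (with_proj G)"

lemma sym_parcs: "(w, z) \<in> parcs G \<longleftrightarrow> (z, w) \<in> parcs G"
  using pair_sym_arcs by (auto simp: symmetric_def sym_def)

lemma connected_to_sym: "connected_to x y \<longleftrightarrow> connected_to y x"
  using symmetric_reachable[OF pair_sym_arcs] by blast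

text \<open>
  Summation by parts over the arcs. Each edge occurs as two opposite arcs, whence the factor 1/2. The
  right-hand side is symmetric in \<open>d\<close> and \<open>e\<close>, and for \<open>e = d\<close> it is the energy of the potential.
\<close>

lemma green_identity:
  "(\<Sum>w\<in>pverts G. d w * outflow G e w) =
   (\<Sum>(w, z)\<in>parcs G. (d w - d z) * (e w - e z)) / 2"
proof -
  let ?S = "\<lambda>F. \<Sum>(w, z)\<in>parcs G. (F w z :: real)"
  have arcs: "parcs G = Sigma (pverts G) (\<lambda>w. {z. (w, z) \<in> parcs G})"
    by (auto dest: in_arcsD1)
  have fin: "finite {z. (w, z) \<in> parcs G}" for w
    by (rule finite_subset[of _ "snd ` parcs G"]) (force simp: pair_finite_arcs)+
  have "(\<Sum>w\<in>pverts G. d w * outflow G e w) =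
      (\<Sum>w\<in>pverts G. \<Sum>z | (w, z) \<in> parcs G. d w * (e w - e z))"
    by (simp add: outflow_def sum_distrib_left)
  also have "\<dots> = ?S (\<lambda>w z. d w * (e w - e z))"
    using pair_finite_verts fin by (subst arcs, subst sum.Sigma) auto
  finally have *: "(\<Sum>w\<in>pverts G. d w * outflow G e w) = ?S (\<lambda>w z. d w * (e w - e z))" .
  have **: "?S (\<lambda>w z. d w * (e w - e z)) = ?S (\<lambda>w z. d z * (e z - e w))"
    by (rule sum.reindex_bij_witness[where i = prod.swap and j = prod.swap])
      (auto simp: sym_parcs[symmetric])
  have "?S (\<lambda>w z. (d w - d z) * (e w - e z)) =
      ?S (\<lambda>w z. d w * (e w - e z)) + ?S (\<lambda>w z. d z * (e z - e w))"
    unfolding sum.distrib[symmetric] by (rule sum.cong) (auto simp: algebra_simps)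
  with * ** show ?thesis by simp
qed

lemma outflow_symmetric:
  "(\<Sum>w\<in>pverts G. d w * outflow G e w) = (\<Sum>w\<in>pverts G. e w * outflow G d w)"
  unfolding green_identity by (simp add: mult.commute)

text \<open>
  The energy is a sum of squares of differences along arcs, so if it vanishes, no arc carries a
  current. This is the source of both uniqueness and existence of potentials.
\<close>

lemma zero_energy_constant:
  assumes "(\<Sum>w\<in>pverts G. d w * outflow G d w) = 0" and "connected_to x y"
  shows "d x = d y"
proof -
  have "(\<Sum>(w, z)\<in>parcs G. (d w - d z) * (d w - d z)) = 0"
    using assms(1) by (simp add: green_identity)
  then have "\<forall>e\<in>parcs G. (case e of (w, z) \<Rightarrow> (d w - d z) * (d w - d z)) = 0"
    by (subst (asm) sum_nonneg_eq_0_iff) (auto simp: pair_finite_arcs)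
  then have arc: "d w = d z" if "(w, z) \<in> parcs G" for w z
    using that by auto
  from assms(2) show ?thesis
    by (induct rule: reachable_induct) (auto dest: arc)
qed

lemma total_outflow: "(\<Sum>w\<in>pverts G. outflow G f w) = 0"
  using outflow_symmetric[of "\<lambda>_. 1" f] by (simp add: outflow_def)

lemma unit_current_potential_unique:
  assumes "unit_current_potential G x y f" "unit_current_potential G x y k" "connected_to x y"
  shows "f x - f y = k x - k y"
proof -
  let ?d = "\<lambda>v. f v - k v"
  have "outflow G ?d w = 0" if "w \<in> pverts G" for w
    using assms(1,2) that by (simp add: outflow_diff unit_current_potential_iff_outflow)
  then have "?d x = ?d y"
    by (intro zero_energy_constant[OF _ assms(3)]) simp
  then show ?thesis by simp
qed

text \<open>
  Ground the network at \<open>y\<close> and solve Kirchhoff's equations on the rest \<open>W\<close> of the component of \<open>y\<close>,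
  with potential 0 outside \<open>W\<close>. This square system has trivial kernel: a solution of the homogeneous
  system has zero energy, because at every vertex either the potential or the outflow vanishes, and so
  it equals its value 0 at \<open>y\<close>. The equation at \<open>y\<close>, which was left out, follows because outflows
  add up to 0.
\<close>

lemma unit_current_potential_exists:
  assumes "connected_to x y"
  shows "\<exists>f. unit_current_potential G x y f"
proof -
  define W where "W = {w. connected_to w y} - {y}"
  have "W \<subseteq> pverts G" unfolding W_def using reachable_in_verts by auto
  then have fin: "finite W" using pair_finite_verts finite_subset by blast
  have y: "y \<in> pverts G" and x: "x \<in> pverts G" using assms reachable_in_verts by auto
  define A where "A w c = outflow G (\<lambda>v. if v = c then 1 else 0) w" for w c
  define ground where "ground f v = (if v \<in> W then f v else 0)" for f :: "'a \<Rightarrow> real" and v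
  have A: "(\<Sum>c\<in>W. A w c * f c) = outflow G (ground f) w" for f w
  proof -
    have "(\<Sum>c\<in>W. A w c * f c) =
        (\<Sum>c\<in>W. \<Sum>z | (w, z) \<in> parcs G. ((if w = c then 1 else 0) - (if z = c then 1 else 0)) * f c)"
      by (simp add: A_def outflow_def sum_distrib_right)
    also have "\<dots> = (\<Sum>z | (w, z) \<in> parcs G. \<Sum>c\<in>W. (if w = c then f c else 0) - (if z = c then f c else 0))"
      by (subst sum.swap) (auto intro!: sum.cong)
    also have "\<dots> = outflow G (ground f) w"
      using fin by (simp add: outflow_def ground_def sum_subtractf)
    finally show ?thesis .
  qed
  have "\<exists>f. \<forall>w\<in>W. (\<Sum>c\<in>W. A w c * f c) = unit_source x y w"
  proof (rule injective_linear_system_solvable[OF fin fin refl])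
    fix f assume f: "\<forall>w\<in>W. (\<Sum>c\<in>W. A w c * f c) = 0"
    then have "ground f w * outflow G (ground f) w = 0" for w
      by (auto simp: A ground_def)
    then have "ground f w = ground f y" if "w \<in> W" for w
      using that by (intro zero_energy_constant sum.neutral) (auto simp: W_def)
    then show "\<forall>w\<in>W. f w = 0" by (auto simp: ground_def W_def)
  qed
  then obtain f where f: "\<And>w. w \<in> W \<Longrightarrow> outflow G (ground f) w = unit_source x y w"
    unfolding A by blast
  \<comment> \<open>outside the component both sides vanish, since no arc leaves the component\<close>
  have away: "outflow G (ground f) w = unit_source x y w" if w: "w \<noteq> y" for w
  proof (cases "w \<in> W")
    case False
    then have "\<not> connected_to w y" using w by (simp add: W_def)
    then have "z \<notin> W" if "(w, z) \<in> parcs G" for z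
      using adj_reachable_trans[OF that] by (auto simp: W_def)
    moreover have "w \<noteq> x" using \<open>\<not> connected_to w y\<close> assms by blast
    ultimately show ?thesis
      using False w by (simp add: outflow_def ground_def unit_source_def)
  qed (rule f)
  have "outflow G (ground f) y = unit_source x y y"
  proof -
    have "(\<Sum>w\<in>pverts G. outflow G (ground f) w) = (\<Sum>w\<in>pverts G. unit_source x y w)"
      using sum_unit_source[OF pair_finite_verts x y, of "\<lambda>_. 1"] by (simp add: total_outflow)
    moreover have "(\<Sum>w\<in>pverts G - {y}. outflow G (ground f) w) =
        (\<Sum>w\<in>pverts G - {y}. unit_source x y w)"
      by (rule sum.cong) (auto simp: away)
    ultimately show ?thesis
      by (simp add: sum.remove[OF pair_finite_verts y])
  qed
  with away show ?thesis
    unfolding unit_current_potential_iff_outflow by metis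
qed

lemma resistance_distance_eq_voltage:
  assumes "connected_to x y" "unit_current_potential G x y f"
  shows "resistance_distance G x y = ereal (f x - f y)"
proof -
  have "(THE r. \<exists>f. unit_current_potential G x y f \<and> r = f x - f y) = f x - f y"
    by (rule the_equality) (use assms unit_current_potential_unique in blast)+
  then show ?thesis using assms(1) by (simp add: resistance_distance_def)
qed

lemma resistance_distance_self:
  assumes "x \<in> pverts G"
  shows "resistance_distance G x x = 0"
proof -
  have "unit_current_potential G x x (\<lambda>_. 0)" by (simp add: unit_current_potential_def)
  with resistance_distance_eq_voltage[of x x] assms show ?thesis by simp
qed

text \<open>
  The voltage between \<open>u\<close> and \<open>v\<close> caused by a unit current from \<open>x\<close> to \<open>y\<close> is the voltage between
  \<open>x\<close> and \<open>y\<close> caused by a unit current from \<open>u\<close> to \<open>v\<close>, because the Laplacian is symmetric.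
\<close>

lemma voltage_reciprocity:
  assumes "unit_current_potential G x y f" "unit_current_potential G u v k"
    and "connected_to x y" "connected_to u v"
  shows "f u - f v = k x - k y"
proof -
  have verts: "x \<in> pverts G" "y \<in> pverts G" "u \<in> pverts G" "v \<in> pverts G"
    using assms(3,4) reachable_in_verts by auto
  have "f u - f v = (\<Sum>w\<in>pverts G. f w * outflow G k w)"
    using assms(2) verts pair_finite_verts
    by (simp add: unit_current_potential_iff_outflow sum_unit_source)
  also have "\<dots> = (\<Sum>w\<in>pverts G. k w * outflow G f w)"
    by (rule outflow_symmetric)
  also have "\<dots> = k x - k y"
    using assms(1) verts pair_finite_verts
    by (simp add: unit_current_potential_iff_outflow sum_unit_source)
  finally show ?thesis .
qed

end

section \<open>Blocks of a network as retracts\<close>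

text \<open>
  \<open>B\<close> is embedded in \<open>K\<close> by \<open>\<iota>\<close>, and \<open>\<rho>\<close> retracts \<open>K\<close> onto \<open>B\<close> in such a way that every arc outside the
  image of \<open>B\<close> is collapsed to a point. This says that whatever is attached to \<open>B\<close> within \<open>K\<close> is attached
  at single vertices: \<open>\<rho>\<close> maps a vertex of \<open>K\<close> to the vertex of \<open>B\<close> through which it is attached.
\<close>

locale network_retract = B: pair_graph B + K: pair_graph K
  for B :: "'b pair_pre_digraph" and K :: "'k pair_pre_digraph" +
  fixes \<iota> :: "'b \<Rightarrow> 'k" and \<rho> :: "'k \<Rightarrow> 'b"
  assumes embed_verts: "v \<in> pverts B \<Longrightarrow> \<iota> v \<in> pverts K"
    and embed_arcs: "(v, w) \<in> parcs B \<Longrightarrow> (\<iota> v, \<iota> w) \<in> parcs K"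
    and retract_verts: "z \<in> pverts K \<Longrightarrow> \<rho> z \<in> pverts B"
    and retract_embed: "v \<in> pverts B \<Longrightarrow> \<rho> (\<iota> v) = v"
    and arc_in_block_or_collapsed:
      "(y, z) \<in> parcs K \<Longrightarrow> (\<exists>v w. (v, w) \<in> parcs B \<and> y = \<iota> v \<and> z = \<iota> w) \<or> \<rho> y = \<rho> z"
begin

text \<open>
  Pulling a potential on \<open>B\<close> back along \<open>\<rho>\<close> makes it constant on everything that hangs at a vertex of
  \<open>B\<close>, so that no current flows there.
\<close>

lemma outflow_retract_embed:
  assumes v: "v \<in> pverts B"
  shows "outflow K (\<lambda>z. f (\<rho> z)) (\<iota> v) = outflow B f v"
proof -
  have "outflow K (\<lambda>z. f (\<rho> z)) (\<iota> v) = (\<Sum>z\<in>\<iota> ` {w. (v, w) \<in> parcs B}. f v - f (\<rho> z))"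
    unfolding outflow_def retract_embed[OF v]
  proof (rule sum.mono_neutral_right)
    show "finite {z. (\<iota> v, z) \<in> parcs K}"
      by (rule finite_subset[of _ "snd ` parcs K"]) (force simp: K.pair_finite_arcs)+
    show "\<iota> ` {w. (v, w) \<in> parcs B} \<subseteq> {z. (\<iota> v, z) \<in> parcs K}"
      using embed_arcs by blast
    show "\<forall>z\<in>{z. (\<iota> v, z) \<in> parcs K} - \<iota> ` {w. (v, w) \<in> parcs B}. f v - f (\<rho> z) = 0"
    proof
      fix z assume z: "z \<in> {z. (\<iota> v, z) \<in> parcs K} - \<iota> ` {w. (v, w) \<in> parcs B}"
      have "\<rho> (\<iota> v) = \<rho> z"
        using arc_in_block_or_collapsed[of "\<iota> v" z] z v
        by (metis (mono_tags, lifting) B.in_arcsD1 DiffD1 DiffD2 image_eqI mem_Collect_eq retract_embed)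
      then show "f v - f (\<rho> z) = 0" using v by (simp add: retract_embed)
    qed
  qed
  also have "\<dots> = (\<Sum>w | (v, w) \<in> parcs B. f v - f w)"
  proof (subst sum.reindex)
    show "inj_on \<iota> {w. (v, w) \<in> parcs B}"
      by (rule inj_on_inverseI[of _ \<rho>]) (auto dest: B.in_arcsD2 simp: retract_embed)
    show "(\<Sum>w | (v, w) \<in> parcs B. ((\<lambda>z. f v - f (\<rho> z)) \<circ> \<iota>) w) = (\<Sum>w | (v, w) \<in> parcs B. f v - f w)"
      by (rule sum.cong) (auto dest: B.in_arcsD2 simp: retract_embed)
  qed
  finally show ?thesis by (simp add: outflow_def)
qed

lemma outflow_retract_outside:
  assumes "z \<notin> \<iota> ` pverts B"
  shows "outflow K (\<lambda>z. f (\<rho> z)) z = 0"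
  unfolding outflow_def
proof (rule sum.neutral, rule ballI)
  fix y assume "y \<in> {y. (z, y) \<in> parcs K}"
  with arc_in_block_or_collapsed[of z y] assms have "\<rho> z = \<rho> y"
    using B.in_arcsD1 by blast
  then show "f (\<rho> z) - f (\<rho> y) = 0" by simp
qed

lemma unit_current_potential_retract:
  assumes f: "unit_current_potential B u v f" and uv: "u \<in> pverts B" "v \<in> pverts B"
  shows "unit_current_potential K (\<iota> u) (\<iota> v) (\<lambda>z. f (\<rho> z))"
  unfolding unit_current_potential_iff_outflow
proof
  fix z
  show "outflow K (\<lambda>z. f (\<rho> z)) z = unit_source (\<iota> u) (\<iota> v) z"
  proof (cases "z \<in> \<iota> ` pverts B")
    case True
    then obtain w where w: "w \<in> pverts B" "z = \<iota> w" by blast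
    then have "\<iota> w = \<iota> u \<longleftrightarrow> w = u" "\<iota> w = \<iota> v \<longleftrightarrow> w = v"
      using uv retract_embed by metis+
    then show ?thesis
      using f w by (simp add: outflow_retract_embed unit_current_potential_iff_outflow unit_source_def)
  next
    case False
    then show ?thesis using uv by (auto simp: outflow_retract_outside unit_source_def)
  qed
qed

lemma connected_embed:
  assumes "B.connected_to u v"
  shows "K.connected_to (\<iota> u) (\<iota> v)"
  using assms
proof (induct rule: B.reachable_induct)
  case base
  then show ?case by (auto intro: embed_verts)
next
  case (step v w)
  then show ?case using embed_arcs by (meson K.reachable_adj_trans)
qed

lemma connected_retract:
  assumes "K.connected_to y z"
  shows "B.connected_to (\<rho> y) (\<rho> z)"
  using assms
proof (induct rule: K.reachable_induct)
  case base
  then show ?case by (auto intro: retract_verts)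
next
  case (step z w)
  from arc_in_block_or_collapsed[OF step(2)] show ?case
  proof
    assume "\<exists>v w'. (v, w') \<in> parcs B \<and> z = \<iota> v \<and> w = \<iota> w'"
    then have "(\<rho> z, \<rho> w) \<in> parcs B"
      using retract_embed B.in_arcsD1 B.in_arcsD2 by metis
    with step(3) show ?thesis by (meson B.reachable_adj_trans)
  qed (use step in simp)
qed

lemma resistance_distance_embed:
  assumes uv: "u \<in> pverts B" "v \<in> pverts B"
  shows "resistance_distance K (\<iota> u) (\<iota> v) = resistance_distance B u v"
proof (cases "B.connected_to u v")
  case True
  then obtain f where f: "unit_current_potential B u v f"
    using B.unit_current_potential_exists by blast
  from K.resistance_distance_eq_voltage[OF connected_embed[OF True] unit_current_potential_retract[OF f uv]]
  show ?thesis
    using B.resistance_distance_eq_voltage[OF True f] uv by (simp add: retract_embed)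
next
  case False
  then have "\<not> K.connected_to (\<iota> u) (\<iota> v)"
    using connected_retract[of "\<iota> u" "\<iota> v"] uv by (auto simp: retract_embed)
  with False show ?thesis by (simp add: resistance_distance_def)
qed

text \<open>
  Add a unit current from \<open>\<iota> p\<close> to the cut vertex \<open>\<iota> (\<rho> z)\<close>, flowing inside the block, and one from
  the cut vertex to \<open>z\<close>. The first has the same potential at \<open>z\<close> and at the cut vertex, because \<open>\<rho>\<close>
  identifies the two; by reciprocity the second has the same potential at \<open>\<iota> p\<close> and at the cut
  vertex. Hence the voltages of the two currents add up to the voltage of the sum.
\<close>

lemma resistance_distance_via_cut_vertex:
  assumes p: "p \<in> pverts B" and z: "z \<in> pverts K"
  shows "resistance_distance K (\<iota> p) z =
    resistance_distance B p (\<rho> z) + resistance_distance K (\<iota> (\<rho> z)) z"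
proof (cases "B.connected_to p (\<rho> z) \<and> K.connected_to (\<iota> (\<rho> z)) z")
  case True
  let ?q = "\<rho> z"
  have q: "?q \<in> pverts B" using z by (rule retract_verts)
  obtain f where f: "unit_current_potential B p ?q f"
    using True B.unit_current_potential_exists by blast
  obtain k where k: "unit_current_potential K (\<iota> ?q) z k"
    using True K.unit_current_potential_exists by blast
  let ?F = "\<lambda>y. f (\<rho> y)"
  note F = unit_current_potential_retract[OF f p q]
  have conn: "K.connected_to (\<iota> p) (\<iota> ?q)" using True connected_embed by blast
  have "?F (\<iota> ?q) - ?F z = k (\<iota> p) - k (\<iota> ?q)"
    using K.voltage_reciprocity[OF F k conn] True by blast
  then have k_eq: "k (\<iota> p) = k (\<iota> ?q)" using q by (simp add: retract_embed)
  have "unit_current_potential K (\<iota> p) z (\<lambda>y. ?F y + k y)"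
    using F k by (simp add: unit_current_potential_iff_outflow outflow_add unit_source_def)
  moreover have "K.connected_to (\<iota> p) z" using conn True K.reachable_trans by blast
  ultimately have "resistance_distance K (\<iota> p) z = ereal (?F (\<iota> p) + k (\<iota> p) - (?F z + k z))"
    using K.resistance_distance_eq_voltage by blast
  moreover have "resistance_distance B p ?q = ereal (f p - f ?q)"
    using B.resistance_distance_eq_voltage f True by blast
  moreover have "resistance_distance K (\<iota> ?q) z = ereal (k (\<iota> ?q) - k z)"
    using K.resistance_distance_eq_voltage k True by blast
  ultimately show ?thesis using p k_eq by (simp add: retract_embed)
next
  case False
  have "\<not> K.connected_to (\<iota> p) z"
  proof
    assume c: "K.connected_to (\<iota> p) z"
    then have b: "B.connected_to p (\<rho> z)" using connected_retract[OF c] p by (simp add: retract_embed)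
    then have "K.connected_to (\<iota> (\<rho> z)) (\<iota> p)" using connected_embed K.connected_to_sym by blast
    with c have "K.connected_to (\<iota> (\<rho> z)) z" using K.reachable_trans by blast
    with b False show False by blast
  qed
  with False show ?thesis by (auto simp: resistance_distance_def)
qed

end

section \<open>Rooted graphs glued to the vertices of a core\<close>

text \<open>
  The vertex \<open>x m\<close> of the part \<open>H m\<close> is identified with the vertex \<open>att m\<close> of the core \<open>G\<close>. The map
  \<open>att\<close> is arbitrary; partitions only enter as a way of describing such maps.
\<close>

locale vertex_gluing = G: pair_graph G
  for G :: "'a pair_pre_digraph" +
  fixes I :: "nat set" and H :: "nat \<Rightarrow> 'b pair_pre_digraph" and x :: "nat \<Rightarrow> 'b" and att :: "nat \<Rightarrow> 'a"
  assumes finite_index: "finite I"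
    and graph_H: "m \<in> I \<Longrightarrow> pair_graph (H m)"
    and root: "m \<in> I \<Longrightarrow> x m \<in> pverts (H m)"
    and attachment: "m \<in> I \<Longrightarrow> att m \<in> pverts G"
begin

definition place :: "nat \<Rightarrow> 'b \<Rightarrow> 'a + nat \<times> 'b" where
  "place m v = (if v = x m then Inl (att m) else Inr (m, v))"

definition glued :: "('a + nat \<times> 'b) pair_pre_digraph" where
  "glued = \<lparr> pverts = Inl ` pverts G \<union> (\<Union>m\<in>I. place m ` pverts (H m)),
     parcs = map_prod Inl Inl ` parcs G \<union>
       (\<Union>m\<in>I. map_prod (place m) (place m) ` parcs (H m)) \<rparr>"

text \<open>
  The retractions of the glued graph onto the core and onto a part. A part is reached only through its
  root, so everything outside it collapses to the root.
\<close>

definition collapse_to_core :: "'a + nat \<times> 'b \<Rightarrow> 'a" where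
  "collapse_to_core z = (case z of Inl u \<Rightarrow> u | Inr (m, v) \<Rightarrow> att m)"

definition collapse_to_part :: "nat \<Rightarrow> 'a + nat \<times> 'b \<Rightarrow> 'b" where
  "collapse_to_part m z = (case z of Inl u \<Rightarrow> x m | Inr (l, v) \<Rightarrow> if l = m then v else x m)"

lemma collapse_simps [simp]:
  "collapse_to_core (Inl u) = u"
  "collapse_to_core (Inr (m, v)) = att m"
  "collapse_to_core (place m v) = att m"
  "collapse_to_part m (Inl u) = x m"
  "collapse_to_part m (Inr (l, v)) = (if l = m then v else x m)"
  "collapse_to_part m (place l v) = (if l = m then v else x m)"
  by (auto simp: collapse_to_core_def collapse_to_part_def place_def)

lemma place_eq_iff [simp]: "place m v = place m w \<longleftrightarrow> v = w"
  by (auto simp: place_def)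

lemma pverts_glued:
  "pverts glued = Inl ` pverts G \<union> Inr ` Sigma I (\<lambda>m. pverts (H m) - {x m})"
  using attachment by (fastforce simp: glued_def place_def)

lemma core_arc_in_glued: "(u, v) \<in> parcs G \<Longrightarrow> (Inl u, Inl v) \<in> parcs glued"
  by (force simp: glued_def)

lemma part_arc_in_glued: "m \<in> I \<Longrightarrow> (v, w) \<in> parcs (H m) \<Longrightarrow> (place m v, place m w) \<in> parcs glued"
  by (force simp: glued_def)

lemma glued_arc_cases:
  assumes "(y, z) \<in> parcs glued"
  obtains (core) u v where "(u, v) \<in> parcs G" "y = Inl u" "z = Inl v"
    | (part) m v w where "m \<in> I" "(v, w) \<in> parcs (H m)" "y = place m v" "z = place m w"
  using assms by (fastforce simp: glued_def)

lemma place_in_glued: "m \<in> I \<Longrightarrow> v \<in> pverts (H m) \<Longrightarrow> place m v \<in> pverts glued"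
  by (auto simp: glued_def)

lemma Inl_in_glued: "u \<in> pverts G \<Longrightarrow> Inl u \<in> pverts glued"
  by (auto simp: glued_def)

lemma graph_glued: "pair_graph glued"
proof -
  have ends: "v \<in> pverts (H m) \<and> w \<in> pverts (H m) \<and> v \<noteq> w \<and> (w, v) \<in> parcs (H m)"
    if "m \<in> I" "(v, w) \<in> parcs (H m)" for m v w
  proof -
    interpret Hm: pair_graph "H m" using that(1) by (rule graph_H)
    show ?thesis using that(2) Hm.in_arcsD1 Hm.in_arcsD2 Hm.no_loops' Hm.sym_parcs by blast
  qed
  have wf: "y \<in> pverts glued \<and> z \<in> pverts glued \<and> y \<noteq> z \<and> (z, y) \<in> parcs glued"
    if "(y, z) \<in> parcs glued" for y z
    using that
  proof (cases rule: glued_arc_cases)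
    case (core u v)
    then have "u \<in> pverts G" "v \<in> pverts G" "u \<noteq> v" "(v, u) \<in> parcs G"
      using G.in_arcsD1 G.in_arcsD2 G.no_loops' G.sym_parcs by blast+
    then show ?thesis using core(2,3) by (simp add: Inl_in_glued core_arc_in_glued)
  next
    case (part m v w)
    then show ?thesis
      using ends[OF part(1,2)] by (simp add: place_in_glued part_arc_in_glued)
  qed
  have fin: "finite (pverts glued)" "finite (parcs glued)"
    using finite_index graph_H G.pair_finite_verts G.pair_finite_arcs
    by (auto simp: glued_def pair_graph_def pair_digraph_def pair_fin_digraph_def
        pair_fin_digraph_axioms_def)
  show ?thesis
  proof unfold_locales
    show "symmetric (with_proj glued)"
      using wf by (auto simp: symmetric_def sym_def)
  qed (use wf fin in auto)
qed

sublocale core: network_retract G glued Inl collapse_to_core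
proof -
  interpret K: pair_graph glued by (rule graph_glued)
  show "network_retract G glued Inl collapse_to_core"
  proof unfold_locales
    fix y z assume "(y, z) \<in> parcs glued"
    then show "(\<exists>v w. (v, w) \<in> parcs G \<and> y = Inl v \<and> z = Inl w) \<or>
        collapse_to_core y = collapse_to_core z"
      by (cases rule: glued_arc_cases) auto
  qed (auto simp: Inl_in_glued core_arc_in_glued pverts_glued attachment)
qed

lemma part_retract:
  assumes m: "m \<in> I"
  shows "network_retract (H m) glued (place m) (collapse_to_part m)"
proof -
  interpret K: pair_graph glued by (rule graph_glued)
  interpret Hm: pair_graph "H m" using m by (rule graph_H)
  show ?thesis
  proof unfold_locales
    fix y z assume "(y, z) \<in> parcs glued"
    then show "(\<exists>v w. (v, w) \<in> parcs (H m) \<and> y = place m v \<and> z = place m w) \<or>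
        collapse_to_part m y = collapse_to_part m z"
    proof (cases rule: glued_arc_cases)
      case (part l v w)
      then show ?thesis by (cases "l = m") auto
    qed simp
  next
    fix z assume "z \<in> pverts glued"
    then show "collapse_to_part m z \<in> pverts (H m)"
      using root[OF m] by (auto simp: pverts_glued split: if_splits)
  qed (use m in \<open>simp_all add: place_in_glued part_arc_in_glued\<close>)
qed

lemma distance_core_core:
  "u \<in> pverts G \<Longrightarrow> v \<in> pverts G \<Longrightarrow>
    resistance_distance glued (Inl u) (Inl v) = resistance_distance G u v"
  by (rule core.resistance_distance_embed)

lemma distance_within_part:
  assumes "m \<in> I" "v \<in> pverts (H m) - {x m}" "w \<in> pverts (H m) - {x m}"
  shows "resistance_distance glued (Inr (m, v)) (Inr (m, w)) = resistance_distance (H m) v w"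
  using network_retract.resistance_distance_embed[OF part_retract[OF assms(1)], of v w] assms
  by (simp add: place_def)

text \<open>
  The root of \<open>H m\<close> separates \<open>H m\<close> from the rest of the network.
\<close>

lemma distance_part_outside:
  assumes m: "m \<in> I" "v \<in> pverts (H m) - {x m}"
    and z: "z \<in> pverts glued" "collapse_to_part m z = x m"
  shows "resistance_distance glued (Inr (m, v)) z =
    resistance_distance (H m) (x m) v + resistance_distance glued (Inl (att m)) z"
proof -
  have "resistance_distance (H m) v (x m) = resistance_distance (H m) (x m) v"
    by (rule resistance_distance_commute[OF graph_H[OF m(1)]])
  then show ?thesis
    using network_retract.resistance_distance_via_cut_vertex[OF part_retract[OF m(1)], of v z] m z
    by (simp add: place_def)
qed

lemma distance_part_core:
  assumes m: "m \<in> I" "v \<in> pverts (H m) - {x m}" and u: "u \<in> pverts G"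
  shows "resistance_distance glued (Inr (m, v)) (Inl u) =
    resistance_distance (H m) (x m) v + resistance_distance G (att m) u"
  using distance_part_outside[OF m, of "Inl u"] u m
  by (simp add: Inl_in_glued distance_core_core attachment)

lemma distance_part_part:
  assumes m: "m \<in> I" "v \<in> pverts (H m) - {x m}" and l: "l \<in> I" "w \<in> pverts (H l) - {x l}"
    and "m \<noteq> l"
  shows "resistance_distance glued (Inr (m, v)) (Inr (l, w)) =
    resistance_distance (H m) (x m) v +
      (resistance_distance (H l) (x l) w + resistance_distance G (att m) (att l))"
proof -
  have "resistance_distance glued (Inl (att m)) (Inr (l, w)) =
      resistance_distance glued (Inr (l, w)) (Inl (att m))"
    by (rule resistance_distance_commute[OF graph_glued])
  also have "\<dots> = resistance_distance (H l) (x l) w + resistance_distance G (att m) (att l)"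
    using distance_part_core[OF l attachment[OF m(1)]] resistance_distance_commute[OF G.pair_graph]
    by simp
  finally show ?thesis
    using distance_part_outside[OF m, of "Inr (l, w)"] l \<open>m \<noteq> l\<close> by (auto simp: pverts_glued)
qed

end

section \<open>Spectra as sums over ordered pairs\<close>

text \<open>
  A multiset with at most one element, so that a double sum may run over all pairs of vertices and
  yet omit the diagonal.
\<close>

definition pair_distances :: "'a pair_pre_digraph \<Rightarrow> 'a \<Rightarrow> 'a \<Rightarrow> ereal multiset" where
  "pair_distances K p q = (if p = q then {#} else {#resistance_distance K p q#})"

definition ordered_spectrum :: "'a pair_pre_digraph \<Rightarrow> ereal multiset" where
  "ordered_spectrum K = (\<Sum>p\<in>pverts K. \<Sum>q\<in>pverts K. pair_distances K p q)"

lemma sum_singleton_mset: "finite A \<Longrightarrow> (\<Sum>a\<in>A. {#f a#}) = image_mset f (mset_set A)"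
  by (induct A rule: finite_induct) auto

text \<open>
  Over ordered pairs the spectrum becomes a double sum in the additive monoid of multisets, which
  splits along any decomposition of the vertex set. Every unordered pair is counted twice, and doubling
  a multiset loses no information.
\<close>

lemma ordered_spectrum_eq_double:
  assumes "pair_graph K"
  shows "ordered_spectrum K = resistance_spectrum K + resistance_spectrum K"
proof -
  interpret pair_graph K by fact
  let ?V = "pverts K"
  let ?E = "{e. e \<subseteq> ?V \<and> card e = 2}"
  let ?O = "{e \<in> ?V \<times> ?V. fst e \<noteq> snd e}"
  have finO: "finite ?O" and finE: "finite ?E"
    using pair_finite_verts by auto
  have "ordered_spectrum K = (\<Sum>(p, q)\<in>?V \<times> ?V. pair_distances K p q)"
    by (simp add: ordered_spectrum_def sum.cartesian_product)
  also have "\<dots> = (\<Sum>(p, q)\<in>?O. {#resistance_distance K p q#})"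
    by (rule sum.mono_neutral_cong_right) (auto simp: pair_distances_def pair_finite_verts)
  also have "\<dots> = (\<Sum>e\<in>?E. \<Sum>(p, q)\<in>{d \<in> ?O. {fst d, snd d} = e}. {#resistance_distance K p q#})"
    by (rule sum.group[symmetric, OF finO finE]) (auto simp: card_2_iff)
  also have "\<dots> = (\<Sum>e\<in>?E. {#pair_resistance K e#} + {#pair_resistance K e#})"
  proof (rule sum.cong[OF refl])
    fix e assume "e \<in> ?E"
    then obtain u v where e: "e = {u, v}" "u \<noteq> v" "u \<in> ?V" "v \<in> ?V"
      by (auto simp: card_2_iff)
    then have "{d \<in> ?O. {fst d, snd d} = e} = {(u, v), (v, u)}"
      by (auto simp: doubleton_eq_iff)
    moreover have "resistance_distance K v u = resistance_distance K u v"
      by (rule resistance_distance_commute[OF assms])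
    ultimately show "(\<Sum>(p, q)\<in>{d \<in> ?O. {fst d, snd d} = e}. {#resistance_distance K p q#}) =
        {#pair_resistance K e#} + {#pair_resistance K e#}"
      using e by (simp add: pair_resistance_doubleton[OF assms])
  qed
  also have "\<dots> = resistance_spectrum K + resistance_spectrum K"
    by (simp only: sum.distrib sum_singleton_mset[OF finE] resistance_spectrum_def)
  finally show ?thesis .
qed

lemma resistance_spectrum_eqI:
  assumes "pair_graph K" "pair_graph L" "ordered_spectrum K = ordered_spectrum L"
  shows "resistance_spectrum K = resistance_spectrum L"
proof (rule multiset_eqI)
  fix r
  have "count (ordered_spectrum K) r = count (ordered_spectrum L) r"
    using assms(3) by simp
  then show "count (resistance_spectrum K) r = count (resistance_spectrum L) r"
    by (simp add: ordered_spectrum_eq_double assms(1,2))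
qed

lemma sum_mset_RSV:
  fixes F :: "ereal \<Rightarrow> 'c::comm_monoid_add"
  shows "(\<Sum>r\<in>#RSV K c. F r) = (\<Sum>v\<in>pverts K - {c}. F (resistance_distance K c v))"
  by (simp add: RSV_def sum_unfold_sum_mset image_mset.compositionality comp_def)

context vertex_gluing
begin

lemma sum_pverts_glued:
  fixes F :: "'a + nat \<times> 'b \<Rightarrow> 'c::comm_monoid_add"
  shows "(\<Sum>z\<in>pverts glued. F z) =
    (\<Sum>u\<in>pverts G. F (Inl u)) + (\<Sum>m\<in>I. \<Sum>v\<in>pverts (H m) - {x m}. F (Inr (m, v)))"
proof -
  have fin: "finite (pverts (H m))" if "m \<in> I" for m
    using graph_H[OF that] by (simp add: pair_graph_def pair_digraph_def pair_fin_digraph_def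
        pair_fin_digraph_axioms_def)
  have "(\<Sum>z\<in>pverts glued. F z) = (\<Sum>z\<in>Inl ` pverts G. F z) +
      (\<Sum>z\<in>Inr ` Sigma I (\<lambda>m. pverts (H m) - {x m}). F z)"
    unfolding pverts_glued using finite_index fin G.pair_finite_verts
    by (intro sum.union_disjoint) auto
  also have "(\<Sum>z\<in>Inl ` pverts G. F z) = (\<Sum>u\<in>pverts G. F (Inl u))"
    by (subst sum.reindex) auto
  also have "(\<Sum>z\<in>Inr ` Sigma I (\<lambda>m. pverts (H m) - {x m}). F z) =
      (\<Sum>m\<in>I. \<Sum>v\<in>pverts (H m) - {x m}. F (Inr (m, v)))"
    using finite_index fin by (subst sum.reindex, simp, subst sum.Sigma) (auto simp: comp_def)
  finally show ?thesis .
qed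

text \<open>
  The distances of the vertices of a part from its root: all that a part shows to the outside.
\<close>

definition rays :: "nat \<Rightarrow> ereal multiset" where
  "rays m = RSV (H m) (x m)"

definition core_part_distances :: "ereal multiset" where
  "core_part_distances =
    (\<Sum>m\<in>I. \<Sum>u\<in>pverts G. \<Sum>r\<in>#rays m. {#r + resistance_distance G (att m) u#})"

definition part_part_distances :: "nat \<Rightarrow> nat \<Rightarrow> ereal multiset" where
  "part_part_distances m l =
    (\<Sum>r\<in>#rays m. \<Sum>r'\<in>#rays l. {#r + (r' + resistance_distance G (att m) (att l))#})"

text \<open>
  The four kinds of pairs of vertices: both in the core, both in the same part, one in the core and one
  in a part (in two orders), or in two different parts. Roots count as vertices of the core.
\<close>

lemma ordered_spectrum_glued:
  "ordered_spectrum glued = ordered_spectrum G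
     + (\<Sum>m\<in>I. \<Sum>v\<in>pverts (H m) - {x m}. \<Sum>w\<in>pverts (H m) - {x m}. pair_distances (H m) v w)
     + (core_part_distances + core_part_distances)
     + (\<Sum>(m, l) | m \<in> I \<and> l \<in> I \<and> m \<noteq> l. part_part_distances m l)"
proof -
  let ?D = "pair_distances glued"
  let ?H = "\<lambda>m. pverts (H m) - {x m}"
  let ?within = "\<lambda>m. \<Sum>v\<in>?H m. \<Sum>w\<in>?H m. pair_distances (H m) v w"
  have cc: "(\<Sum>u\<in>pverts G. \<Sum>v\<in>pverts G. ?D (Inl u) (Inl v)) = ordered_spectrum G"
    unfolding ordered_spectrum_def
    by (intro sum.cong refl) (simp add: pair_distances_def distance_core_core)
  have pc: "(\<Sum>m\<in>I. \<Sum>v\<in>?H m. \<Sum>u\<in>pverts G. ?D (Inr (m, v)) (Inl u)) = core_part_distances"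
    unfolding core_part_distances_def
  proof (rule sum.cong[OF refl])
    fix m assume m: "m \<in> I"
    have "(\<Sum>v\<in>?H m. \<Sum>u\<in>pverts G. ?D (Inr (m, v)) (Inl u)) =
        (\<Sum>v\<in>?H m. \<Sum>u\<in>pverts G.
          {#resistance_distance (H m) (x m) v + resistance_distance G (att m) u#})"
      by (intro sum.cong refl) (simp add: pair_distances_def distance_part_core[OF m])
    also have "\<dots> = (\<Sum>u\<in>pverts G. \<Sum>r\<in>#rays m. {#r + resistance_distance G (att m) u#})"
      unfolding rays_def sum_mset_RSV by (rule sum.swap)
    finally show "(\<Sum>v\<in>?H m. \<Sum>u\<in>pverts G. ?D (Inr (m, v)) (Inl u)) =
        (\<Sum>u\<in>pverts G. \<Sum>r\<in>#rays m. {#r + resistance_distance G (att m) u#})" .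
  qed
  have cp: "(\<Sum>u\<in>pverts G. \<Sum>m\<in>I. \<Sum>v\<in>?H m. ?D (Inl u) (Inr (m, v))) = core_part_distances"
  proof -
    have "?D (Inl u) (Inr (m, v)) = ?D (Inr (m, v)) (Inl u)" for u m v
      by (simp add: pair_distances_def resistance_distance_commute[OF graph_glued, of "Inl u"])
    then have "(\<Sum>u\<in>pverts G. \<Sum>m\<in>I. \<Sum>v\<in>?H m. ?D (Inl u) (Inr (m, v))) =
        (\<Sum>u\<in>pverts G. \<Sum>m\<in>I. \<Sum>v\<in>?H m. ?D (Inr (m, v)) (Inl u))"
      by simp
    also have "\<dots> = (\<Sum>m\<in>I. \<Sum>u\<in>pverts G. \<Sum>v\<in>?H m. ?D (Inr (m, v)) (Inl u))"
      by (rule sum.swap)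
    also have "\<dots> = (\<Sum>m\<in>I. \<Sum>v\<in>?H m. \<Sum>u\<in>pverts G. ?D (Inr (m, v)) (Inl u))"
      by (rule sum.cong[OF refl], rule sum.swap)
    finally show ?thesis using pc by simp
  qed
  have block: "(\<Sum>v\<in>?H m. \<Sum>w\<in>?H l. ?D (Inr (m, v)) (Inr (l, w))) =
      (if m = l then ?within m else part_part_distances m l)" if ml: "m \<in> I" "l \<in> I" for m l
  proof (cases "m = l")
    case True
    then show ?thesis
      by (simp, intro sum.cong refl) (simp add: pair_distances_def distance_within_part[OF ml(2)])
  next
    case False
    then show ?thesis
      unfolding part_part_distances_def rays_def sum_mset_RSV
      by (simp, intro sum.cong refl)
        (simp add: pair_distances_def distance_part_part[OF ml(1) _ ml(2)])
  qed
  have pp: "(\<Sum>m\<in>I. \<Sum>v\<in>?H m. \<Sum>l\<in>I. \<Sum>w\<in>?H l. ?D (Inr (m, v)) (Inr (l, w))) =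
      (\<Sum>m\<in>I. ?within m) + (\<Sum>(m, l) | m \<in> I \<and> l \<in> I \<and> m \<noteq> l. part_part_distances m l)"
  proof -
    let ?f = "\<lambda>m l. if m = l then ?within m else {#}"
    let ?g = "\<lambda>m l. if m \<noteq> l then part_part_distances m l else {#}"
    have "(\<Sum>m\<in>I. \<Sum>v\<in>?H m. \<Sum>l\<in>I. \<Sum>w\<in>?H l. ?D (Inr (m, v)) (Inr (l, w))) =
        (\<Sum>m\<in>I. \<Sum>l\<in>I. \<Sum>v\<in>?H m. \<Sum>w\<in>?H l. ?D (Inr (m, v)) (Inr (l, w)))"
      by (rule sum.cong[OF refl], rule sum.swap)
    also have "\<dots> = (\<Sum>m\<in>I. \<Sum>l\<in>I. ?f m l + ?g m l)"
      by (intro sum.cong refl) (simp add: block)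
    also have "\<dots> = (\<Sum>m\<in>I. \<Sum>l\<in>I. ?f m l) + (\<Sum>m\<in>I. \<Sum>l\<in>I. ?g m l)"
      by (simp only: sum.distrib)
    also have "(\<Sum>m\<in>I. \<Sum>l\<in>I. ?f m l) = (\<Sum>m\<in>I. ?within m)"
      using finite_index by (intro sum.cong refl) simp
    also have "(\<Sum>m\<in>I. \<Sum>l\<in>I. ?g m l) = (\<Sum>(m, l)\<in>I \<times> I. ?g m l)"
      by (rule sum.cartesian_product)
    also have "\<dots> = (\<Sum>(m, l) | m \<in> I \<and> l \<in> I \<and> m \<noteq> l. part_part_distances m l)"
      using finite_index by (intro sum.mono_neutral_cong_right) auto
    finally show ?thesis .
  qed
  have "ordered_spectrum glued =
      (\<Sum>u\<in>pverts G. \<Sum>v\<in>pverts G. ?D (Inl u) (Inl v)) +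
      (\<Sum>m\<in>I. \<Sum>v\<in>?H m. \<Sum>u\<in>pverts G. ?D (Inr (m, v)) (Inl u)) +
      ((\<Sum>u\<in>pverts G. \<Sum>m\<in>I. \<Sum>v\<in>?H m. ?D (Inl u) (Inr (m, v))) +
       (\<Sum>m\<in>I. \<Sum>v\<in>?H m. \<Sum>l\<in>I. \<Sum>w\<in>?H l. ?D (Inr (m, v)) (Inr (l, w))))"
    by (simp only: ordered_spectrum_def sum_pverts_glued sum.distrib)
  then show ?thesis
    unfolding cc pc cp pp by (simp add: ac_simps)
qed

end

section \<open>Redistributing the parts over a resistance-transitive set\<close>

text \<open>
  The transposition of \<open>s\<close> and \<open>s'\<close> turns the distances from \<open>s\<close> into those from \<open>s'\<close>: a vertex outside
  \<open>S\<close> is equidistant from both, and any other vertex of \<open>S\<close> has the common distance from both.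
\<close>

lemma resistance_transitive_sum:
  fixes F :: "ereal \<Rightarrow> 'c::comm_monoid_add"
  assumes "pair_graph G" "resistance_transitive G S" "s \<in> S" "s' \<in> S"
  shows "(\<Sum>u\<in>pverts G. F (resistance_distance G s u)) =
    (\<Sum>u\<in>pverts G. F (resistance_distance G s' u))"
proof -
  let ?R = "resistance_distance G"
  let ?\<tau> = "Transposition.transpose s s'"
  have S: "S \<subseteq> pverts G" using assms(2) by (simp add: resistance_transitive_def)
  obtain c where c: "\<And>u v. u \<in> S \<Longrightarrow> v \<in> S \<Longrightarrow> u \<noteq> v \<Longrightarrow> ?R u v = c"
    using assms(2) unfolding resistance_transitive_def by blast
  have out: "?R s u = ?R s' u" if "u \<in> pverts G - S" for u
  proof -
    have "?R u s = ?R u s'"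
      using assms(2-4) that unfolding resistance_transitive_def by blast
    then show ?thesis
      using resistance_distance_commute[OF assms(1), of u] by simp
  qed
  have self: "?R s s = 0" "?R s' s' = 0"
    using pair_graph.resistance_distance_self[OF assms(1)] S assms(3,4) by auto
  have "?R s' (?\<tau> u) = ?R s u" if u: "u \<in> pverts G" for u
  proof (cases "u = s \<or> u = s'")
    case True
    then show ?thesis
      using self resistance_distance_commute[OF assms(1), of s s'] by auto
  next
    case False
    then show ?thesis
      using c[of s u] c[of s' u] out[of u] u assms(3,4) by (cases "u \<in> S") (auto simp: transpose_def)
  qed
  then show ?thesis
    by (intro sum.reindex_bij_witness[where i = ?\<tau> and j = ?\<tau>])
      (use S assms(3,4) in \<open>auto simp: transpose_def\<close>)
qed

lemma sum_two_values_cong: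
  fixes c d :: "'c::comm_monoid_add"
  assumes "finite A" "card {e \<in> A. P e} = card {e \<in> A. Q e}"
  shows "(\<Sum>e\<in>A. if P e then c else d) = (\<Sum>e\<in>A. if Q e then c else d)"
proof -
  have const: "(\<Sum>e\<in>B. k) = (\<Sum>e\<in>C. k)"
    if "finite B" "finite C" "card B = card C" for B C :: "'a set" and k :: 'c
  proof -
    obtain h where "bij_betw h B C" using finite_same_card_bij \<open>finite B\<close> \<open>finite C\<close> \<open>card B = card C\<close> by blast
    then show ?thesis using sum.reindex_bij_betw[of h B C "\<lambda>_. k"] by simp
  qed
  have compl: "card {e \<in> A. \<not> P e} = card {e \<in> A. \<not> Q e}"
  proof -
    have "card {e \<in> A. \<not> X e} = card A - card {e \<in> A. X e}" for X
      using assms(1) by (subst card_Diff_subset[symmetric]) (auto intro!: arg_cong[of _ _ card])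
    then show ?thesis using assms(2) by simp
  qed
  have split: "(\<Sum>e\<in>A. if X e then c else d) = (\<Sum>e | e \<in> A \<and> X e. c) + (\<Sum>e | e \<in> A \<and> \<not> X e. d)" for X
    using assms(1) by (simp add: sum.If_cases Int_def conj_commute Collect_neg_eq[symmetric])
  show ?thesis
    unfolding split
    using const[of "{e \<in> A. P e}" "{e \<in> A. Q e}" c] const[of "{e \<in> A. \<not> P e}" "{e \<in> A. \<not> Q e}" d]
      assms compl by simp
qed

text \<open>
  Only the distances between different parts notice a change of the attachments. Such a pair of parts
  contributes the multiset \<open>\<Psi> 0\<close> if the parts share their attachment vertex and \<open>\<Psi> c\<close> if not, where
  \<open>c\<close> is the common distance in \<open>S\<close> and \<open>\<Psi>\<close> is the same for all pairs, as all parts have the same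
  distances from the root.
\<close>

lemma resistance_spectrum_glued_cong:
  assumes glue: "vertex_gluing G I H x att" "vertex_gluing G I H x att'"
    and transitive: "resistance_transitive G S" and att: "att ` I \<subseteq> S" "att' ` I \<subseteq> S"
    and rsv: "\<And>m l. m \<in> I \<Longrightarrow> l \<in> I \<Longrightarrow> RSV (H m) (x m) = RSV (H l) (x l)"
    and same: "card {(m, l) \<in> I \<times> I. att m = att l} = card {(m, l) \<in> I \<times> I. att' m = att' l}"
  shows "resistance_spectrum (vertex_gluing.glued G I H x att) =
    resistance_spectrum (vertex_gluing.glued G I H x att')"
proof -
  interpret A: vertex_gluing G I H x att by fact
  interpret B: vertex_gluing G I H x att' by fact
  let ?R = "resistance_distance G"
  let ?O = "{(m, l). m \<in> I \<and> l \<in> I \<and> m \<noteq> l}"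
  have finO: "finite ?O"
    by (rule finite_subset[of _ "I \<times> I"]) (auto simp: A.finite_index)
  have cp: "A.core_part_distances = B.core_part_distances"
    unfolding A.core_part_distances_def B.core_part_distances_def A.rays_def B.rays_def
    by (intro sum.cong[OF refl] resistance_transitive_sum[OF A.G.pair_graph transitive]) (use att in auto)
  have count: "card {e \<in> ?O. f (fst e) = f (snd e)} = card {(m, l) \<in> I \<times> I. f m = f l} - card I"
    for f :: "nat \<Rightarrow> 'a"
  proof -
    have "{e \<in> ?O. f (fst e) = f (snd e)} = {(m, l) \<in> I \<times> I. f m = f l} - (\<lambda>m. (m, m)) ` I"
      by auto
    moreover have "card ({(m, l) \<in> I \<times> I. f m = f l} - (\<lambda>m. (m, m)) ` I) =
        card {(m, l) \<in> I \<times> I. f m = f l} - card ((\<lambda>m. (m, m)) ` I)"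
      using A.finite_index by (intro card_Diff_subset) auto
    moreover have "card ((\<lambda>m. (m, m)) ` I) = card I"
      by (rule card_image) (auto intro: inj_onI)
    ultimately show ?thesis by simp
  qed
  have pp: "(\<Sum>(m, l)\<in>?O. A.part_part_distances m l) = (\<Sum>(m, l)\<in>?O. B.part_part_distances m l)"
  proof (cases "I = {}")
    case False
    then obtain k where k: "k \<in> I" by blast
    obtain c where c: "\<And>u v. u \<in> S \<Longrightarrow> v \<in> S \<Longrightarrow> u \<noteq> v \<Longrightarrow> ?R u v = c"
      using transitive unfolding resistance_transitive_def by blast
    have S: "S \<subseteq> pverts G" using transitive by (simp add: resistance_transitive_def)
    have R: "?R u v = (if u = v then 0 else c)" if "u \<in> S" "v \<in> S" for u v
      using that c S A.G.resistance_distance_self by auto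
    define \<Psi> where "\<Psi> d = (\<Sum>r\<in>#A.rays k. \<Sum>r'\<in>#A.rays k. {#r + (r' + d)#})" for d
    have rays: "A.rays m = A.rays k" "B.rays m = A.rays k" if "m \<in> I" for m
      using rsv[OF that k] by (auto simp: A.rays_def B.rays_def)
    have "(\<Sum>(m, l)\<in>?O. A.part_part_distances m l) =
        (\<Sum>e\<in>?O. if att (fst e) = att (snd e) then \<Psi> 0 else \<Psi> c)"
      by (rule sum.cong[OF refl])
        (use att in \<open>auto simp: A.part_part_distances_def rays \<Psi>_def R image_subset_iff\<close>)
    also have "\<dots> = (\<Sum>e\<in>?O. if att' (fst e) = att' (snd e) then \<Psi> 0 else \<Psi> c)"
      by (rule sum_two_values_cong[OF finO]) (simp only: count same)
    also have "\<dots> = (\<Sum>(m, l)\<in>?O. B.part_part_distances m l)"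
      by (rule sum.cong[OF refl])
        (use att in \<open>auto simp: B.part_part_distances_def rays \<Psi>_def R image_subset_iff\<close>)
    finally show ?thesis .
  qed simp
  have "ordered_spectrum A.glued = ordered_spectrum B.glued"
    unfolding A.ordered_spectrum_glued B.ordered_spectrum_glued cp pp ..
  then show ?thesis
    by (rule resistance_spectrum_eqI[OF A.graph_glued B.graph_glued])
qed

section \<open>Attachments given by a partition\<close>

lemma sum_list_take_mono: "i \<le> j \<Longrightarrow> sum_list (take i a) \<le> sum_list (take j (a :: nat list))"
  by (auto simp: le_iff_add take_add)

abbreviation part_interval :: "nat list \<Rightarrow> nat \<Rightarrow> nat set" where
  "part_interval a i \<equiv> {sum_list (take i a) + 1..sum_list (take (Suc i) a)}"

lemma card_part_interval: "i < length a \<Longrightarrow> card (part_interval a i) = a ! i"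
  by (simp add: take_Suc_conv_app_nth)

lemma part_interval_unique:
  assumes "m \<in> part_interval a i" "m \<in> part_interval a j"
  shows "i = j"
proof (rule ccontr)
  assume "i \<noteq> j"
  then have "Suc i \<le> j \<or> Suc j \<le> i" by linarith
  then show False
    using sum_list_take_mono[of "Suc i" j a] sum_list_take_mono[of "Suc j" i a] assms by auto
qed

lemma part_interval_exists:
  assumes "m \<in> {1..sum_list a}"
  shows "\<exists>i<length a. m \<in> part_interval a i"
proof -
  define k where "k = (LEAST k. m \<le> sum_list (take k a))"
  have len: "m \<le> sum_list (take (length a) a)" using assms by simp
  have k: "m \<le> sum_list (take k a)" unfolding k_def using len by (rule LeastI)
  have kl: "k \<le> length a" unfolding k_def using len by (rule Least_le)
  from k assms have "k \<noteq> 0" by (intro notI) simp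
  then obtain i where i: "k = Suc i" by (cases k) auto
  have "\<not> m \<le> sum_list (take i a)"
    using not_less_Least[of i "\<lambda>k. m \<le> sum_list (take k a)"] i unfolding k_def by simp
  with k kl i show ?thesis by (intro exI[of _ i]) auto
qed

lemma attachment_vertex_eq:
  assumes "i < length a" "m \<in> part_interval a i"
  shows "attachment_vertex ss a m = ss ! i"
proof -
  have "(THE i. i < length a \<and> sum_list (take i a) + 1 \<le> m \<and> m \<le> sum_list (take (Suc i) a)) = i"
    using assms part_interval_unique[of m _ a] by (intro the_equality) auto
  then show ?thesis by (simp add: attachment_vertex_def)
qed

lemma attachment_vertex_in_set:
  assumes "m \<in> {1..sum_list a}" "length a \<le> length ss"
  shows "attachment_vertex ss a m \<in> set ss"
  using part_interval_exists[OF assms(1)] attachment_vertex_eq[of _ a m ss] assms(2) by auto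

text \<open>
  The indices attached to a given vertex form one of the intervals, of length \<open>a ! i\<close>, so the pairs
  form the disjoint union of the squares of these intervals.
\<close>

lemma card_common_attachment:
  assumes "distinct ss" "length a \<le> length ss"
  shows "card {(m, l) \<in> {1..sum_list a} \<times> {1..sum_list a}.
      attachment_vertex ss a m = attachment_vertex ss a l} = (\<Sum>c\<in>#mset a. c\<^sup>2)"
    (is "card ?P = _")
proof -
  let ?J = "part_interval a"
  have J: "?J i \<subseteq> {1..sum_list a}" if "i < length a" for i
    using sum_list_take_mono[of "Suc i" "length a" a] that by auto
  have "?P = (\<Union>i<length a. ?J i \<times> ?J i)"
  proof (intro equalityI subsetI)
    fix e assume "e \<in> ?P"
    then obtain m l where e: "e = (m, l)" "m \<in> {1..sum_list a}" "l \<in> {1..sum_list a}"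
        "attachment_vertex ss a m = attachment_vertex ss a l" by blast
    obtain i j where i: "i < length a" "m \<in> ?J i" and j: "j < length a" "l \<in> ?J j"
      using part_interval_exists e(2,3) by meson
    have "ss ! i = ss ! j" using e(4) attachment_vertex_eq i j by metis
    then have "i = j" using assms i(1) j(1) by (simp add: nth_eq_iff_index_eq)
    then show "e \<in> (\<Union>i<length a. ?J i \<times> ?J i)" using i j e(1) by blast
  next
    fix e assume "e \<in> (\<Union>i<length a. ?J i \<times> ?J i)"
    then obtain i m l where i: "i < length a" "m \<in> ?J i" "l \<in> ?J i" "e = (m, l)" by blast
    then have "attachment_vertex ss a m = attachment_vertex ss a l"
      using attachment_vertex_eq by metis
    then show "e \<in> ?P" using i J by blast
  qed
  also have "card \<dots> = (\<Sum>i<length a. card (?J i \<times> ?J i))"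
  proof (rule card_UN_disjoint)
    show "\<forall>i\<in>{..<length a}. \<forall>j\<in>{..<length a}. i \<noteq> j \<longrightarrow> ?J i \<times> ?J i \<inter> ?J j \<times> ?J j = {}"
      using part_interval_unique[of _ _ a] by blast
  qed auto
  also have "\<dots> = (\<Sum>i<length a. (a ! i)\<^sup>2)"
    by (rule sum.cong[OF refl])
      (simp only: card_cartesian_product card_part_interval lessThan_iff power2_eq_square)
  also have "\<dots> = (\<Sum>c\<in>#mset a. c\<^sup>2)"
    by (simp add: sum_mset_sum_list sum_list_sum_nth atLeast0LessThan flip: mset_map)
  finally show ?thesis .
qed

section \<open>Partitions with equal sums of squares\<close>

theorem theorem3p2:
  fixes G :: "'a pair_pre_digraph" and g :: "nat \<Rightarrow> 'a" and n s t :: nat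
    and H :: "nat \<Rightarrow> 'b pair_pre_digraph" and h :: "nat \<Rightarrow> nat \<Rightarrow> 'b" and nn :: "nat \<Rightarrow> nat"
    and a b :: "nat list"
  assumes "pair_graph G" and "bij_betw g {1..n} (pverts G)"
    and "3 \<le> s" and "s \<le> n"
    and "resistance_transitive G (g ` {1..s})"
    and "t > 0"
    and "\<And>i. i \<in> {1..t} \<Longrightarrow> pair_graph (H i)"
    and "\<And>i. i \<in> {1..t} \<Longrightarrow> nn i \<ge> 1 \<and> bij_betw (h i) {1..nn i} (pverts (H i))"
    and "\<And>i j. i \<in> {1..t} \<Longrightarrow> j \<in> {1..t} \<Longrightarrow> relation_U (H i) (h i 1) (H j) (h j 1)"
    and "partition_of (mset a) t" and "partition_of (mset b) t"
    and "length a \<le> s" and "length b \<le> s"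
    and "equal_sums_of_squares (mset a) (mset b)"
  shows "resistance_spectrum (glued_graph G (map g [1..<Suc s]) a H (\<lambda>i. h i 1)) =
         resistance_spectrum (glued_graph G (map g [1..<Suc s]) b H (\<lambda>i. h i 1))"
proof -
  let ?ss = "map g [1..<Suc s]"
  let ?x = "\<lambda>i. h i 1"
  have set_ss: "set ?ss = g ` {1..s}"
    by (simp only: set_map set_upt atLeastLessThanSuc_atLeastAtMost)
  have S: "g ` {1..s} \<subseteq> pverts G"
    using assms(5) by (simp add: resistance_transitive_def)
  have len: "length ?ss = s" by simp
  have distinct: "distinct ?ss"
  proof -
    have "inj_on g {1..s}"
      using assms(2,4) by (auto simp: bij_betw_def intro: inj_on_subset)
    then show ?thesis
      by (simp only: distinct_map distinct_upt set_upt atLeastLessThanSuc_atLeastAtMost)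
  qed
  have sums: "sum_list a = t" "sum_list b = t"
    using assms(10,11) by (simp_all add: partition_of_def sum_mset_sum_list)
  have gluing: "vertex_gluing G {1..t} H ?x (attachment_vertex ?ss c) \<and>
      attachment_vertex ?ss c ` {1..t} \<subseteq> g ` {1..s} \<and>
      glued_graph G ?ss c H ?x = vertex_gluing.glued G {1..t} H ?x (attachment_vertex ?ss c)"
    if c: "sum_list c = t" "length c \<le> s" for c
  proof -
    have att: "attachment_vertex ?ss c m \<in> g ` {1..s}" if "m \<in> {1..t}" for m
      using attachment_vertex_in_set[of m c ?ss] that c len unfolding set_ss by simp
    have root: "?x m \<in> pverts (H m)" if "m \<in> {1..t}" for m
      using assms(8)[OF that] bij_betw_apply[of "h m" "{1..nn m}" "pverts (H m)" 1] by auto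
    have "vertex_gluing G {1..t} H ?x (attachment_vertex ?ss c)"
      unfolding vertex_gluing_def vertex_gluing_axioms_def
      using assms(1,7) root att S by blast
    moreover from this have "glue_map ?ss c ?x =
        vertex_gluing.place ?x (attachment_vertex ?ss c)"
      by (intro ext) (simp only: glue_map_def vertex_gluing.place_def)
    ultimately show ?thesis
      using att by (auto simp only: glued_graph_def vertex_gluing.glued_def c(1))
  qed
  note A = gluing[OF sums(1) assms(12)] and B = gluing[OF sums(2) assms(13)]
  have same: "card {(m, l) \<in> {1..t} \<times> {1..t}. attachment_vertex ?ss a m = attachment_vertex ?ss a l} =
      card {(m, l) \<in> {1..t} \<times> {1..t}. attachment_vertex ?ss b m = attachment_vertex ?ss b l}"
    using card_common_attachment[OF distinct, of a] card_common_attachment[OF distinct, of b]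
      assms(12-14) len sums by (simp only: equal_sums_of_squares_def)
  have rsv: "RSV (H m) (?x m) = RSV (H l) (?x l)" if "m \<in> {1..t}" "l \<in> {1..t}" for m l
    using assms(9)[OF that] by (simp only: relation_U_def)
  show ?thesis
    unfolding A[THEN conjunct2, THEN conjunct2] B[THEN conjunct2, THEN conjunct2]
    by (rule resistance_spectrum_glued_cong[OF A[THEN conjunct1] B[THEN conjunct1] assms(5)
          A[THEN conjunct2, THEN conjunct1] B[THEN conjunct2, THEN conjunct1] _ same])
      (rule rsv)
qed

end
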